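(* Let $\Omega$ be a quiver with either finite zeroth homology or finite first homology. Then for any element $n$ of the root space of $\Omega$, the limit $\langle n,n\rangle_\Omega$ converges to an element of $\mathbb{Z}\cup\{\pm\infty\}$.
   Context: A quiver $\Omega=(\Omega_0,\Omega_1)$ is a (possibly infinite) set $\Omega_0$ of vertices and a set $\Omega_1$ of ordered pairs of vertices (arrows); for $a=(i,j)$, $s(a)=i$ and $t(a)=j$. $\Omega$ has finite zeroth homology if the zeroth homology of its underlying graph has finite rank (finitely many connected components), and finite first homology if the first homology of its underlying graph has finite rank (finitely many cycles). The root space of $\Omega$ is the set of functions $n:\Omega_0\to\mathbb{Z}$ such that $n_{s(a)}=n_{t(a)}$ for all but finitely many arrows $a$. A subquiver $\Omega'$ of $\Omega$ (not necessarily full) is IC if no connected component of $\Omega$ contains more than one connected component of $\Omega'$. For a finite subquiver $\Omega'$ put $\langle n,n\rangle_{\Omega'}=\sum_{i\in\Omega'_0}n_i^2-\sum_{a\in\Omega'_1}n_{s(a)}n_{t(a)}$. $\langle n,n\rangle_\Omega$ denotes the limit, in $\mathbb{Z}\cup\{\pm\infty\}$ (subspace topology from the extended reals), of the net $\Omega'\mapsto\langle n,n\rangle_{\Omega'}$ over the set of finite IC subquivers of $\Omega$ directed by inclusion. *)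

theory Defs
  imports
    "Graph_Theory.Graph_Theory"
    "HOL-Algebra.Free_Abelian_Groups"
    "HOL-Analysis.Analysis"
begin

text \<open>
  A quiver is a \<^locale>\<open>pair_wf_digraph\<close>: its arrows form a set of ordered pairs of vertices, so there
  are no parallel arrows, but loops and pairs of opposite arrows are allowed, and nothing need be
  finite.  The tail \<open>s(a)\<close> and head \<open>t(a)\<close> of an arrow are \<^term>\<open>fst a\<close> and \<^term>\<open>snd a\<close>.
\<close>

subsection \<open>Homology of the underlying graph\<close>

text \<open>
  Every arrow is an edge of the underlying graph (oriented as the arrow), so a loop and a pair of
  opposite arrows are cycles.
\<close>

definition quiver_boundary :: "('a \<times> 'a \<Rightarrow>\<^sub>0 int) \<Rightarrow> ('a \<Rightarrow>\<^sub>0 int)" where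
  "quiver_boundary = frag_extend (\<lambda>a. frag_of (snd a) - frag_of (fst a))"

definition zeroth_homology :: "'a pair_pre_digraph \<Rightarrow> ('a \<Rightarrow>\<^sub>0 int) set monoid" where
  "zeroth_homology Q =
     free_Abelian_group (pverts Q) Mod (quiver_boundary ` carrier (free_Abelian_group (parcs Q)))"

definition first_homology :: "'a pair_pre_digraph \<Rightarrow> ('a \<times> 'a \<Rightarrow>\<^sub>0 int) monoid" where
  "first_homology Q =
     subgroup_generated (free_Abelian_group (parcs Q))
       (kernel (free_Abelian_group (parcs Q)) (free_Abelian_group (pverts Q)) quiver_boundary)"

definition int_independent :: "('g, 'm) monoid_scheme \<Rightarrow> 'g set \<Rightarrow> bool" where
  "int_independent G S \<longleftrightarrow> S \<subseteq> carrier G \<and>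
     (\<forall>T c. finite T \<longrightarrow> T \<subseteq> S \<longrightarrow> finprod G (\<lambda>x. x [^]\<^bsub>G\<^esub> (c x :: int)) T = \<one>\<^bsub>G\<^esub> \<longrightarrow> (\<forall>x\<in>T. c x = 0))"

definition finite_rank :: "('g, 'm) monoid_scheme \<Rightarrow> bool" where
  "finite_rank G \<longleftrightarrow> (\<exists>r. \<forall>S. int_independent G S \<longrightarrow> finite S \<and> card S \<le> r)"

subsection \<open>Finite IC subquivers\<close>

text \<open>
  Vertex sets of the connected components: as in the library's notion of connectedness, these are
  the strong components of the symmetrization.
\<close>

definition components_verts :: "'a pair_pre_digraph \<Rightarrow> 'a set set" where
  "components_verts Q = pre_digraph.sccs_verts (mk_symmetric Q)"

abbreviation subquiver :: "'a pair_pre_digraph \<Rightarrow> 'a pair_pre_digraph \<Rightarrow> bool" where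
  "subquiver P Q \<equiv> subgraph (with_proj P) (with_proj Q)"

definition IC :: "'a pair_pre_digraph \<Rightarrow> 'a pair_pre_digraph \<Rightarrow> bool" where
  "IC P Q \<longleftrightarrow> subquiver P Q \<and>
     (\<forall>C\<in>components_verts Q. \<forall>D\<in>components_verts P. \<forall>D'\<in>components_verts P.
        D \<subseteq> C \<longrightarrow> D' \<subseteq> C \<longrightarrow> D = D')"

definition finite_ICs :: "'a pair_pre_digraph \<Rightarrow> 'a pair_pre_digraph set" where
  "finite_ICs Q = {P. pair_fin_digraph P \<and> IC P Q}"

text \<open>The filter of the net indexed by the finite IC subquivers, which are directed by inclusion.\<close>

definition finite_ICs_at_top :: "'a pair_pre_digraph \<Rightarrow> 'a pair_pre_digraph filter" where
  "finite_ICs_at_top Q =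
     (INF P\<in>finite_ICs Q. principal {P' \<in> finite_ICs Q. subquiver P P'})"

lemma subquiver_iff:
  fixes P Q :: "'a pair_pre_digraph"
  shows "subquiver P Q \<longleftrightarrow> pair_wf_digraph P \<and> pair_wf_digraph Q \<and>
     pverts P \<subseteq> pverts Q \<and> parcs P \<subseteq> parcs Q"
proof -
  have wf: "wf_digraph (with_proj G) \<longleftrightarrow> pair_wf_digraph G" for G :: "'a pair_pre_digraph"
    by (auto simp: wf_digraph_def pair_wf_digraph_def)
  show ?thesis
    unfolding subgraph_def by (auto simp: wf compatible_def)
qed

lemma reachable_mk_symmetric_iff:
  fixes Q :: "'a pair_pre_digraph"
  assumes "pair_wf_digraph Q"
  shows "u \<rightarrow>\<^sup>*\<^bsub>mk_symmetric Q\<^esub> v \<longleftrightarrow> u \<in> pverts Q \<and> (u, v) \<in> (parcs Q \<union> (parcs Q)\<inverse>)\<^sup>*"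
proof -
  interpret pair_wf_digraph Q by fact
  have arcs: "parcs (mk_symmetric Q) = parcs Q \<union> (parcs Q)\<inverse>"
    by (auto simp: parcs_mk_symmetric)
  have stay: "b \<in> pverts Q" if "(a, b) \<in> parcs Q \<union> (parcs Q)\<inverse>" for a b
    using that wellformed' by blast
  show ?thesis
  proof
    assume "u \<rightarrow>\<^sup>*\<^bsub>mk_symmetric Q\<^esub> v"
    then have "(u, v) \<in> rtrancl_on (pverts Q) (parcs Q \<union> (parcs Q)\<inverse>)"
      by (simp add: reachable_def arcs)
    then show "u \<in> pverts Q \<and> (u, v) \<in> (parcs Q \<union> (parcs Q)\<inverse>)\<^sup>*"
      by (metis in_rtrancl_on_in_F(1) rtrancl_on_rtranclI)
  next
    assume *: "u \<in> pverts Q \<and> (u, v) \<in> (parcs Q \<union> (parcs Q)\<inverse>)\<^sup>*"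
    then have "v \<in> pverts Q"
      by (metis rtrancl.cases stay)
    then have "(u, v) \<in> rtrancl_on (pverts Q) (parcs Q \<union> (parcs Q)\<inverse>)"
      using * stay by (auto intro: rtrancl_consistent_rtrancl_on)
    then show "u \<rightarrow>\<^sup>*\<^bsub>mk_symmetric Q\<^esub> v"
      by (simp add: reachable_def arcs)
  qed
qed

lemma components_verts_eq:
  assumes "pair_wf_digraph Q"
  shows "components_verts Q = (\<lambda>u. {v. (u, v) \<in> (parcs Q \<union> (parcs Q)\<inverse>)\<^sup>*}) ` pverts Q"
proof -
  interpret Q: pair_wf_digraph Q by fact
  interpret S: pair_wf_digraph "mk_symmetric Q"
    by (rule Q.wellformed_mk_symmetric[simplified])
  let ?R = "parcs Q \<union> (parcs Q)\<inverse>"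
  have sym: "(v, u) \<in> ?R\<^sup>*" if "(u, v) \<in> ?R\<^sup>*" for u v
    using that by (meson sym_rtrancl sym_Un_converse symE)
  have stay: "b \<in> pverts Q" if "(a, b) \<in> ?R\<^sup>*" "a \<in> pverts Q" for a b
    using that by (induction rule: rtrancl_induct) (use Q.wellformed' in blast)+
  have "pre_digraph.scc_of (mk_symmetric Q) u = {v. (u, v) \<in> ?R\<^sup>*}" if "u \<in> pverts Q" for u
    using that sym stay
    by (auto simp: pre_digraph.scc_of_def reachable_mk_symmetric_iff[OF assms])
  then show ?thesis
    unfolding components_verts_def S.sccs_verts_conv_scc_of by (auto intro!: image_cong)
qed

lemma IC_iff:
  fixes P Q :: "'a pair_pre_digraph"
  shows "IC P Q \<longleftrightarrow> subquiver P Q \<and>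
     (\<forall>u\<in>pverts P. \<forall>v\<in>pverts P. (u, v) \<in> (parcs Q \<union> (parcs Q)\<inverse>)\<^sup>* \<longrightarrow>
        (u, v) \<in> (parcs P \<union> (parcs P)\<inverse>)\<^sup>*)"
proof (cases "subquiver P Q")
  case True
  then have wf: "pair_wf_digraph P" "pair_wf_digraph Q"
    and sub: "pverts P \<subseteq> pverts Q" "parcs P \<subseteq> parcs Q"
    by (auto simp: subquiver_iff)
  let ?p = "(parcs P \<union> (parcs P)\<inverse>)\<^sup>*" and ?q = "(parcs Q \<union> (parcs Q)\<inverse>)\<^sup>*"
  have pq: "?p \<subseteq> ?q"
    using sub(2) by (intro rtrancl_mono) auto
  have psym: "(v, u) \<in> ?p" if "(u, v) \<in> ?p" for u v
    using that by (meson sym_rtrancl sym_Un_converse symE)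
  have qsym: "(v, u) \<in> ?q" if "(u, v) \<in> ?q" for u v
    using that by (meson sym_rtrancl sym_Un_converse symE)
  have 1: "{v. (u, v) \<in> ?p} = {v. (u', v) \<in> ?p} \<longleftrightarrow> (u, u') \<in> ?p" for u u'
    using psym by (blast intro: rtrancl_trans)
  have 2: "{v. (u, v) \<in> ?p} \<subseteq> {v. (w, v) \<in> ?q} \<longleftrightarrow> (w, u) \<in> ?q" for u w
    using pq by (blast intro: rtrancl_trans)
  have "IC P Q \<longleftrightarrow> (\<forall>w\<in>pverts Q. \<forall>u\<in>pverts P. \<forall>v\<in>pverts P.
      (w, u) \<in> ?q \<longrightarrow> (w, v) \<in> ?q \<longrightarrow> (u, v) \<in> ?p)"
    using True unfolding IC_def components_verts_eq[OF wf(1)] components_verts_eq[OF wf(2)]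
    by (simp add: 1 2)
  also have "\<dots> \<longleftrightarrow> (\<forall>u\<in>pverts P. \<forall>v\<in>pverts P. (u, v) \<in> ?q \<longrightarrow> (u, v) \<in> ?p)"
    using sub(1) qsym by (meson rtrancl_trans rtrancl.rtrancl_refl subsetD)
  finally show ?thesis
    using True by simp
qed (simp add: IC_def)

lemma finite_connected_subquiver:
  assumes "pair_wf_digraph Q" "u \<in> pverts Q" "(u, v) \<in> (parcs Q \<union> (parcs Q)\<inverse>)\<^sup>*"
  shows "\<exists>P. pair_fin_digraph P \<and> subquiver P Q \<and> u \<in> pverts P \<and> v \<in> pverts P \<and>
     (\<forall>x\<in>pverts P. (u, x) \<in> (parcs P \<union> (parcs P)\<inverse>)\<^sup>*)"
  using assms(3)
proof (induction rule: rtrancl_induct)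
  case base
  show ?case
    by (rule exI[of _ "\<lparr>pverts = {u}, parcs = {}\<rparr>"])
      (use assms in \<open>auto simp: subquiver_iff pair_fin_digraph_def pair_wf_digraph_def
        pair_fin_digraph_axioms_def\<close>)
next
  case (step y z)
  then obtain P where P: "pair_fin_digraph P" "subquiver P Q" "u \<in> pverts P" "y \<in> pverts P"
    "\<And>x. x \<in> pverts P \<Longrightarrow> (u, x) \<in> (parcs P \<union> (parcs P)\<inverse>)\<^sup>*"
    by blast
  obtain a where a: "a \<in> parcs Q" "a = (y, z) \<or> a = (z, y)"
    using step.hyps(2) by auto
  have zQ: "z \<in> pverts Q"
    using a assms(1) by (force simp: pair_wf_digraph_def)
  define P' where "P' = \<lparr>pverts = insert z (pverts P), parcs = insert a (parcs P)\<rparr>"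
  let ?r = "(parcs P' \<union> (parcs P')\<inverse>)\<^sup>*"
  have "(parcs P \<union> (parcs P)\<inverse>)\<^sup>* \<subseteq> ?r"
    by (intro rtrancl_mono) (auto simp: P'_def)
  then have old: "(u, x) \<in> ?r" if "x \<in> pverts P" for x
    using P(5) that by blast
  have "(y, z) \<in> parcs P' \<union> (parcs P')\<inverse>"
    using a(2) by (auto simp: P'_def)
  then have "(u, z) \<in> ?r"
    using old[OF P(4)] by (rule rtrancl_into_rtrancl[rotated])
  moreover have "pair_fin_digraph P'"
    using P(1,4) a(2)
    by (auto simp: P'_def pair_fin_digraph_def pair_wf_digraph_def pair_fin_digraph_axioms_def)
  moreover from this have "subquiver P' Q"
    using P(2) zQ a(1) assms(1)
    by (auto simp: subquiver_iff pair_fin_digraph_def P'_def)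
  ultimately show ?case
    using P(3) old by (intro exI[of _ P']) (auto simp: P'_def)
qed

lemma finite_subset_of_finite_IC:
  assumes wf: "pair_wf_digraph Q"
    and V: "finite V" "V \<subseteq> pverts Q" and A: "finite A" "A \<subseteq> parcs Q"
  shows "\<exists>P\<in>finite_ICs Q. V \<subseteq> pverts P \<and> A \<subseteq> parcs P"
proof -
  let ?q = "(parcs Q \<union> (parcs Q)\<inverse>)\<^sup>*"
  define W where "W = V \<union> fst ` A \<union> snd ` A"
  define I where "I = {(u, v). u \<in> W \<and> v \<in> W \<and> (u, v) \<in> ?q}"
  have W: "finite W" "W \<subseteq> pverts Q"
    using V A pair_wf_digraph.arc_fst_in_verts[OF wf] pair_wf_digraph.arc_snd_in_verts[OF wf]
    by (auto simp: W_def)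
  have I: "finite I" "\<And>w. w \<in> W \<Longrightarrow> (w, w) \<in> I"
    by (rule finite_subset[of _ "W \<times> W"]) (use W in \<open>auto simp: I_def\<close>)
  have "\<forall>i\<in>I. \<exists>P. pair_fin_digraph P \<and> subquiver P Q \<and> fst i \<in> pverts P \<and> snd i \<in> pverts P \<and>
     (\<forall>x\<in>pverts P. (fst i, x) \<in> (parcs P \<union> (parcs P)\<inverse>)\<^sup>*)"
    using W by (auto simp: I_def intro!: finite_connected_subquiver[OF wf])
  then obtain F where F: "\<And>i. i \<in> I \<Longrightarrow> pair_fin_digraph (F i) \<and> subquiver (F i) Q \<and>
     fst i \<in> pverts (F i) \<and> snd i \<in> pverts (F i) \<and>
     (\<forall>x\<in>pverts (F i). (fst i, x) \<in> (parcs (F i) \<union> (parcs (F i))\<inverse>)\<^sup>*)"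
    by metis
  define P where "P = \<lparr>pverts = (\<Union>i\<in>I. pverts (F i)), parcs = (\<Union>i\<in>I. parcs (F i)) \<union> A\<rparr>"
  let ?p = "(parcs P \<union> (parcs P)\<inverse>)\<^sup>*"
  have WP: "W \<subseteq> pverts P"
    using F I(2) by (fastforce simp: P_def)
  have finP: "pair_fin_digraph P"
  proof
    show "finite (pverts P)" "finite (parcs P)"
      using F I(1) A(1) by (simp_all add: P_def pair_fin_digraph.pair_finite_verts
          pair_fin_digraph.pair_finite_arcs)
    show "fst a \<in> pverts P" "snd a \<in> pverts P" if a: "a \<in> parcs P" for a
    proof -
      have "fst a \<in> pverts P \<and> snd a \<in> pverts P"
      proof (cases "a \<in> A")
        case True
        then show ?thesis
          using WP by (auto simp: W_def)
      next
        case False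
        then obtain i where i: "i \<in> I" "a \<in> parcs (F i)"
          using a by (auto simp: P_def)
        then have "pair_wf_digraph (F i)"
          using F by (simp add: pair_fin_digraph_def)
        then have "fst a \<in> pverts (F i)" "snd a \<in> pverts (F i)"
          using i(2) pair_wf_digraph.arc_fst_in_verts pair_wf_digraph.arc_snd_in_verts by blast+
        then show ?thesis
          using i(1) unfolding P_def pair_pre_digraph.select_convs by blast
      qed
      then show "fst a \<in> pverts P" "snd a \<in> pverts P"
        by simp_all
    qed
  qed
  have subP: "subquiver P Q"
  proof -
    have "pverts (F i) \<subseteq> pverts Q" "parcs (F i) \<subseteq> parcs Q" if "i \<in> I" for i
      using F[OF that] by (auto simp: subquiver_iff)
    then have "pverts P \<subseteq> pverts Q" "parcs P \<subseteq> parcs Q"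
      using A(2) unfolding P_def by (simp_all add: UN_least)
    then show ?thesis
      using wf finP by (simp add: subquiver_iff pair_fin_digraph_def)
  qed
  then have pq: "?p \<subseteq> ?q"
    by (intro rtrancl_mono) (auto simp: subquiver_iff)
  have psym: "(v, u) \<in> ?p" if "(u, v) \<in> ?p" for u v
    using that by (meson sym_rtrancl sym_Un_converse symE)
  have qsym: "(v, u) \<in> ?q" if "(u, v) \<in> ?q" for u v
    using that by (meson sym_rtrancl sym_Un_converse symE)
  have FP: "(fst i, x) \<in> ?p" if "i \<in> I" "x \<in> pverts (F i)" for i x
  proof -
    have "(parcs (F i) \<union> (parcs (F i))\<inverse>)\<^sup>* \<subseteq> ?p"
      by (intro rtrancl_mono) (use that in \<open>auto simp: P_def\<close>)
    then show ?thesis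
      using F that by blast
  qed
  have base: "\<exists>w\<in>W. (w, x) \<in> ?p" if x: "x \<in> pverts P" for x
  proof -
    obtain i where i: "i \<in> I" "x \<in> pverts (F i)"
      using x by (auto simp: P_def)
    then have "fst i \<in> W"
      by (auto simp: I_def)
    with FP[OF i] show ?thesis
      by blast
  qed
  have "(u, v) \<in> ?p" if uv: "u \<in> pverts P" "v \<in> pverts P" "(u, v) \<in> ?q" for u v
  proof -
    obtain w w' where w: "w \<in> W" "w' \<in> W" "(w, u) \<in> ?p" "(w', v) \<in> ?p"
      using base uv by metis
    have "(w, w') \<in> ?q"
      using w(3,4) pq uv(3) qsym by (meson rtrancl_trans subsetD)
    then have "(w, w') \<in> I"
      using w by (simp add: I_def)
    then have "(w, w') \<in> ?p"
      using F[of "(w, w')"] FP[of "(w, w')" w'] by simp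
    then show ?thesis
      using w(3,4) psym by (meson rtrancl_trans)
  qed
  then have "P \<in> finite_ICs Q"
    using finP subP by (simp add: finite_ICs_def IC_iff)
  moreover have "V \<subseteq> pverts P" "A \<subseteq> parcs P"
    using WP by (auto simp: W_def P_def)
  ultimately show ?thesis
    by blast
qed

lemma finite_ICs_directed:
  fixes P P' Q :: "'a pair_pre_digraph"
  assumes "P \<in> finite_ICs Q" "P' \<in> finite_ICs Q"
  shows "\<exists>R\<in>finite_ICs Q. subquiver P R \<and> subquiver P' R"
proof -
  have *: "pair_fin_digraph P" "pair_fin_digraph P'" "subquiver P Q" "subquiver P' Q"
    using assms by (auto simp: finite_ICs_def IC_def)
  then obtain R where R: "R \<in> finite_ICs Q"
      "pverts P \<union> pverts P' \<subseteq> pverts R" "parcs P \<union> parcs P' \<subseteq> parcs R"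
    using finite_subset_of_finite_IC[of Q "pverts P \<union> pverts P'" "parcs P \<union> parcs P'"]
    by (auto simp: subquiver_iff pair_fin_digraph_def pair_fin_digraph_axioms_def)
  then show ?thesis
    using * by (intro bexI[of _ R])
      (auto simp: subquiver_iff finite_ICs_def pair_fin_digraph_def)
qed

lemma eventually_finite_ICs_at_top:
  fixes Q :: "'a pair_pre_digraph"
  assumes wf: "pair_wf_digraph Q"
  shows "eventually \<phi> (finite_ICs_at_top Q) \<longleftrightarrow>
     (\<exists>P\<in>finite_ICs Q. \<forall>P'\<in>finite_ICs Q. subquiver P P' \<longrightarrow> \<phi> P')"
proof -
  have ne: "finite_ICs Q \<noteq> {}"
    using finite_subset_of_finite_IC[OF wf, of "{}" "{}"] by auto
  have "\<exists>R\<in>finite_ICs Q. principal {P' \<in> finite_ICs Q. subquiver R P'} \<le>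
      inf (principal {P' \<in> finite_ICs Q. subquiver P1 P'})
          (principal {P' \<in> finite_ICs Q. subquiver P2 P'})"
    if P12: "P1 \<in> finite_ICs Q" "P2 \<in> finite_ICs Q" for P1 P2
  proof -
    obtain R where R: "R \<in> finite_ICs Q" "subquiver P1 R" "subquiver P2 R"
      using finite_ICs_directed[OF P12] by blast
    then have "{P' \<in> finite_ICs Q. subquiver R P'} \<subseteq>
        {P' \<in> finite_ICs Q. subquiver P1 P'} \<inter> {P' \<in> finite_ICs Q. subquiver P2 P'}"
      by (auto simp: subquiver_iff)
    with R(1) show ?thesis
      by (auto simp only: inf_principal principal_le_iff)
  qed
  then show ?thesis
    unfolding finite_ICs_at_top_def
    by (subst eventually_INF_base[OF ne]) (auto simp: eventually_principal)
qed

lemma finite_ICs_at_top_neq_bot: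
  fixes Q :: "'a pair_pre_digraph"
  assumes "pair_wf_digraph Q"
  shows "finite_ICs_at_top Q \<noteq> bot"
proof -
  have "subquiver P P" if "P \<in> finite_ICs Q" for P :: "'a pair_pre_digraph"
    using that by (auto simp: finite_ICs_def IC_def subquiver_iff)
  then show ?thesis
    unfolding trivial_limit_def eventually_finite_ICs_at_top[OF assms] by blast
qed

subsection \<open>The quadratic form\<close>

text \<open>Only the values of \<open>n\<close> on the vertices of \<open>Q\<close> are ever used.\<close>

definition root_space :: "'a pair_pre_digraph \<Rightarrow> ('a \<Rightarrow> int) set" where
  "root_space Q = {n. finite {a \<in> parcs Q. n (fst a) \<noteq> n (snd a)}}"

definition finite_form :: "'a pair_pre_digraph \<Rightarrow> ('a \<Rightarrow> int) \<Rightarrow> int" where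
  "finite_form P n = (\<Sum>i\<in>pverts P. (n i)\<^sup>2) - (\<Sum>a\<in>parcs P. n (fst a) * n (snd a))"

definition extended_ints :: "ereal set" where
  "extended_ints = range (\<lambda>k::int. ereal (of_int k)) \<union> {\<infinity>, -\<infinity>}"

definition form_converges_to :: "'a pair_pre_digraph \<Rightarrow> ('a \<Rightarrow> int) \<Rightarrow> ereal \<Rightarrow> bool" where
  "form_converges_to Q n L \<longleftrightarrow>
     limitin (subtopology euclidean extended_ints)
       (\<lambda>P. ereal (of_int (finite_form P n))) L (finite_ICs_at_top Q)"

end

theory Submission
  imports Defs
begin

text \<open>
  The form is eventually monotone along the net, and a monotone net of integers converges in
  \<open>\<int> \<union> {\<plusminus>\<infinity>}\<close>: it is eventually constant if it is bounded and diverges otherwise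
  (\<open>increasing_int_net_converges\<close>).

  To see the monotonicity, let \<open>P\<close> contain the finitely many arrows along which \<open>n\<close> is not constant,
  and enlarge \<open>P\<close> to \<open>P'\<close>.  Every new vertex \<open>v\<close> contributes \<open>(n v)\<^sup>2\<close>, and every new arrow \<open>a\<close>
  contributes \<open>- (n (fst a))\<^sup>2\<close>, because \<open>n\<close> agrees at its two ends.  Attaching a vertex by an arrow
  to what is already there thus changes nothing; closing a cycle lowers the form, and starting a new
  component raises it.  So the form can only fall once no new components can appear, and it can only
  rise once no new cycles can appear.

  If the zeroth homology has finite rank, then \<open>Q\<close> has finitely many components, since vertices of
  distinct components have independent classes.  Let \<open>P\<close> contain a vertex of each; the IC condition
  then joins every vertex of \<open>P'\<close> to \<open>P\<close> inside \<open>P'\<close>, and the form decreases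
  (\<open>sum_new_verts_le_sum_new_arcs\<close>).

  If the first homology has finite rank, then all but finitely many arrows of \<open>Q\<close> are bridges: an
  arrow outside the supports of a maximal independent set of cycles cannot lie on a further cycle,
  which would be independent of them.  Let \<open>P\<close> contain the arrows that are not bridges; the new
  arrows then form a forest, no tree of which meets \<open>P\<close> twice: by the IC condition that
  would close a cycle.  So the form increases (\<open>sum_new_arcs_le_sum_new_verts\<close>).
\<close>

section \<open>Connectedness by arrows in either direction\<close>

abbreviation linked :: "('a \<times> 'a) set \<Rightarrow> ('a \<times> 'a) set" where
  "linked A \<equiv> (A \<union> A\<inverse>)\<^sup>*"

lemma linked_sym: "(u, v) \<in> linked A \<Longrightarrow> (v, u) \<in> linked A"
  by (meson sym_rtrancl sym_Un_converse symE)

lemma linked_mono: "A \<subseteq> B \<Longrightarrow> (u, v) \<in> linked A \<Longrightarrow> (u, v) \<in> linked B"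
  by (rule subsetD[OF rtrancl_mono]) auto

lemma linked_arc: "a \<in> A \<Longrightarrow> (fst a, snd a) \<in> linked A"
  by (cases a) auto

lemma linked_leaves_set:
  assumes "(u, v) \<in> linked A" "u \<in> V" "v \<notin> V"
  obtains a where "a \<in> A" "fst a \<in> V \<and> snd a \<notin> V \<or> fst a \<notin> V \<and> snd a \<in> V"
proof -
  have "v \<notin> V \<longrightarrow> (\<exists>a\<in>A. fst a \<in> V \<and> snd a \<notin> V \<or> fst a \<notin> V \<and> snd a \<in> V)"
    using assms(1)
  proof (induction rule: rtrancl_induct)
    case base
    then show ?case using assms(2) by simp
  next
    case (step y z)
    then show ?case by fastforce
  qed
  then show ?thesis using assms(3) that by blast
qed

section \<open>Comparing vertex and arrow weights\<close>

text \<open>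
  If every vertex can be reached from \<open>V\<close>, the vertices outside \<open>V\<close> can be attached one at a time,
  each by an arrow that crosses the boundary of the set reached so far.  Distinct vertices use
  distinct arrows, which carry the weights of their vertices.
\<close>
lemma sum_new_verts_le_sum_new_arcs:
  fixes w :: "'a \<Rightarrow> 'b::linordered_idom"
  assumes "finite V'" "finite A'" "V \<subseteq> V'" "A \<subseteq> A'"
    and "\<And>a. a \<in> A' \<Longrightarrow> fst a \<in> V' \<and> snd a \<in> V'"
    and "\<And>a. a \<in> A \<Longrightarrow> fst a \<in> V \<and> snd a \<in> V"
    and "\<And>v. v \<in> V' \<Longrightarrow> \<exists>u\<in>V. (u, v) \<in> linked A'"
    and "\<And>a. a \<in> A' - A \<Longrightarrow> w (fst a) = w (snd a)"
    and "\<And>v. 0 \<le> w v"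
  shows "(\<Sum>v\<in>V' - V. w v) \<le> (\<Sum>a\<in>A' - A. w (fst a))"
  using assms
proof (induction "card (V' - V)" arbitrary: V A rule: less_induct)
  case less
  show ?case
  proof (cases "V' \<subseteq> V")
    case True
    then have none: "V' - V = {}" by blast
    show ?thesis unfolding none using less.prems(9) by (simp add: sum_nonneg)
  next
    case False
    then obtain v where v: "v \<in> V'" "v \<notin> V" by blast
    then obtain u where u: "u \<in> V" "(u, v) \<in> linked A'" using less.prems(7) by blast
    obtain a where a: "a \<in> A'" "fst a \<in> V \<and> snd a \<notin> V \<or> fst a \<notin> V \<and> snd a \<in> V"
      using linked_leaves_set[OF u(2,1) v(2)] .
    \<comment> \<open>Both ends of an old arrow lie in \<open>V\<close>, so the crossing arrow is new.\<close>
    then have aA: "a \<in> A' - A" using less.prems(6) by blast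
    define y where "y = (if fst a \<in> V then snd a else fst a)"
    have y: "y \<in> V' - V" "w y = w (fst a)"
      using a less.prems(5)[OF a(1)] less.prems(8)[OF aA] by (auto simp: y_def)
    have ya: "fst a \<in> insert y V \<and> snd a \<in> insert y V"
      using a(2) by (auto simp: y_def)
    have Vy: "V' - V = insert y (V' - insert y V)" and Aa: "A' - A = insert a (A' - insert a A)"
      using y(1) aA by auto
    have "(\<Sum>v\<in>V' - insert y V. w v) \<le> (\<Sum>a\<in>A' - insert a A. w (fst a))"
    proof (rule less.hyps[OF _ less.prems(1,2) _ _ less.prems(5) _ _ _ less.prems(9)])
      show "card (V' - insert y V) < card (V' - V)"
        using y(1) less.prems(1) by (intro psubset_card_mono) auto
      show "insert y V \<subseteq> V'" "insert a A \<subseteq> A'"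
        using y(1) a(1) less.prems(3,4) by blast+
      show "fst b \<in> insert y V \<and> snd b \<in> insert y V" if "b \<in> insert a A" for b
        using that ya less.prems(6) by blast
      show "w (fst b) = w (snd b)" if "b \<in> A' - insert a A" for b
        using that less.prems(8) by blast
      show "\<exists>u\<in>insert y V. (u, v) \<in> linked A'" if "v \<in> V'" for v
        using less.prems(7)[OF that] by blast
    qed
    moreover have "(\<Sum>v\<in>V' - V. w v) = w y + (\<Sum>v\<in>V' - insert y V. w v)"
      by (subst Vy, subst sum.insert) (use less.prems(1) in auto)
    moreover have "(\<Sum>a\<in>A' - A. w (fst a)) = w (fst a) + (\<Sum>a\<in>A' - insert a A. w (fst a))"
      by (subst Aa, subst sum.insert) (use less.prems(2) in auto)
    ultimately show ?thesis using y(2) by simp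
  qed
qed

text \<open>
  When the new arrows are bridges and \<open>A'\<close> links no vertices of \<open>V\<close> that \<open>A\<close> does not link, the
  graph can be grown so that every new arrow arrives together with a new vertex: either some new
  arrow has exactly one end in \<open>V\<close> and is attached as a leaf, or no new arrow touches \<open>V\<close> and an
  isolated vertex is added first.  Both steps preserve the linking condition.
\<close>
lemma sum_new_arcs_le_sum_new_verts:
  fixes w :: "'a \<Rightarrow> 'b::linordered_idom"
  assumes "finite V'" "finite A'" "V \<subseteq> V'" "A \<subseteq> A'"
    and "\<And>a. a \<in> A' \<Longrightarrow> fst a \<in> V' \<and> snd a \<in> V'"
    and "\<And>a. a \<in> A \<Longrightarrow> fst a \<in> V \<and> snd a \<in> V"
    and "\<And>u v. u \<in> V \<Longrightarrow> v \<in> V \<Longrightarrow> (u, v) \<in> linked A' \<Longrightarrow> (u, v) \<in> linked A"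
    and "\<And>a. a \<in> A' - A \<Longrightarrow> (fst a, snd a) \<notin> linked (A' - {a})"
    and "\<And>a. a \<in> A' - A \<Longrightarrow> w (fst a) = w (snd a)"
    and "\<And>v. 0 \<le> w v"
  shows "(\<Sum>a\<in>A' - A. w (fst a)) \<le> (\<Sum>v\<in>V' - V. w v)"
  using assms
proof (induction "card (V' - V)" arbitrary: V A rule: less_induct)
  case less
  have sumV: "(\<Sum>v\<in>V' - V. w v) = w y + (\<Sum>v\<in>V' - insert y V. w v)" if "y \<in> V' - V" for y
  proof -
    have Vy: "V' - V = insert y (V' - insert y V)" using that by auto
    show ?thesis by (subst Vy, subst sum.insert) (use less.prems(1) in auto)
  qed
  have card: "card (V' - insert y V) < card (V' - V)" if "y \<in> V' - V" for y
    using that less.prems(1) by (intro psubset_card_mono) auto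
  \<comment> \<open>The ends of a new arrow inside \<open>V\<close> would already be linked by \<open>A\<close>, which omits that arrow.\<close>
  have no_chord: "\<not> (fst a \<in> V \<and> snd a \<in> V)" if a: "a \<in> A' - A" for a
  proof
    assume "fst a \<in> V \<and> snd a \<in> V"
    then have "(fst a, snd a) \<in> linked A" using less.prems(7) linked_arc[of a A'] a by blast
    moreover have "A \<subseteq> A' - {a}" using a less.prems(4) by auto
    ultimately have "(fst a, snd a) \<in> linked (A' - {a})" by (rule linked_mono[rotated])
    then show False using less.prems(8)[OF a] by contradiction
  qed
  consider (all_old) "A' \<subseteq> A"
    | (leaf) a where "a \<in> A' - A" "fst a \<in> V \<or> snd a \<in> V"
    | (apart) a where "a \<in> A' - A" "\<And>b. b \<in> A' - A \<Longrightarrow> fst b \<notin> V \<and> snd b \<notin> V"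
    by blast
  then show ?case
  proof cases
    case all_old
    then have none: "A' - A = {}" by blast
    show ?thesis unfolding none using less.prems(10) by (simp add: sum_nonneg)
  next
    case leaf
    define x where "x = (if fst a \<in> V then fst a else snd a)"
    define y where "y = (if fst a \<in> V then snd a else fst a)"
    have xy: "x \<in> V" "y \<in> V' - V" "w y = w (fst a)"
      and ya: "fst a \<in> insert y V \<and> snd a \<in> insert y V"
      using leaf no_chord[OF leaf(1)] less.prems(5)[of a] less.prems(9)[OF leaf(1)]
      by (auto simp: x_def y_def)
    let ?B = "insert a A"
    have xyB: "(x, y) \<in> linked ?B"
      using linked_arc[of a ?B] linked_sym by (auto simp: x_def y_def)
    have "linked ?B \<subseteq> linked A'"
      using leaf(1) less.prems(4) by (intro rtrancl_mono) auto
    then have xyA: "(x, y) \<in> linked A'" using xyB by blast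
    have AB: "(u, v) \<in> linked ?B" if "(u, v) \<in> linked A" for u v
      using that by (rule linked_mono[rotated]) blast
    have toX: "\<exists>u'\<in>V. (u', u) \<in> linked ?B" if "u \<in> insert y V" for u
      using that xy(1) xyB by blast
    have link: "(u, v) \<in> linked ?B"
      if uv: "u \<in> insert y V" "v \<in> insert y V" "(u, v) \<in> linked A'" for u v
    proof -
      obtain u' v' where *: "u' \<in> V" "v' \<in> V" "(u', u) \<in> linked ?B" "(v', v) \<in> linked ?B"
        using toX uv(1,2) by blast
      then have "(u', v') \<in> linked A'"
        using \<open>linked ?B \<subseteq> linked A'\<close> uv(3) linked_sym by (meson rtrancl_trans subsetD)
      then have "(u', v') \<in> linked ?B" using * less.prems(7) AB by blast
      then show ?thesis using *(3,4) linked_sym by (meson rtrancl_trans)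
    qed
    have "(\<Sum>a\<in>A' - ?B. w (fst a)) \<le> (\<Sum>v\<in>V' - insert y V. w v)"
    proof (rule less.hyps[OF card[OF xy(2)] less.prems(1,2) _ _ less.prems(5) _ link _ _ less.prems(10)])
      show "insert y V \<subseteq> V'" "?B \<subseteq> A'"
        using xy(2) leaf(1) less.prems(3,4) by blast+
      show "fst b \<in> insert y V \<and> snd b \<in> insert y V" if "b \<in> ?B" for b
        using that ya less.prems(6) by blast
      show "(fst b, snd b) \<notin> linked (A' - {b})" if "b \<in> A' - ?B" for b
        using less.prems(8)[of b] that by blast
      show "w (fst b) = w (snd b)" if "b \<in> A' - ?B" for b
        using that less.prems(9) by blast
    qed
    moreover have "(\<Sum>a\<in>A' - A. w (fst a)) = w (fst a) + (\<Sum>a\<in>A' - ?B. w (fst a))"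
    proof -
      have Aa: "A' - A = insert a (A' - ?B)" using leaf(1) by auto
      show ?thesis by (subst Aa, subst sum.insert) (use less.prems(2) in auto)
    qed
    ultimately show ?thesis using xy(3) sumV[OF xy(2)] by simp
  next
    case apart
    define y where "y = fst a"
    have y: "y \<in> V' - V" using apart less.prems(5)[of a] by (auto simp: y_def)
    \<comment> \<open>No arrow crosses the boundary of \<open>V\<close>, so the isolated vertex stays unlinked from \<open>V\<close>.\<close>
    have same_side: "fst b \<in> V \<longleftrightarrow> snd b \<in> V" if "b \<in> A'" for b
      using that apart(2) less.prems(6) by blast
    have sep: "(u, y) \<notin> linked A'" if "u \<in> V" for u
      using linked_leaves_set[of u y A' V] same_side that y by (metis DiffD2)
    then have sep': "(y, u) \<notin> linked A'" if "u \<in> V" for u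
      using that linked_sym by metis
    have "(\<Sum>a\<in>A' - A. w (fst a)) \<le> (\<Sum>v\<in>V' - insert y V. w v)"
    proof (rule less.hyps[OF card[OF y] less.prems(1,2) _ less.prems(4,5) _ _ less.prems(8-10)])
      show "insert y V \<subseteq> V'" using y less.prems(3) by blast
      show "fst b \<in> insert y V \<and> snd b \<in> insert y V" if "b \<in> A" for b
        using that less.prems(6) by blast
      show "(u, v) \<in> linked A"
        if "u \<in> insert y V" "v \<in> insert y V" "(u, v) \<in> linked A'" for u v
        using that less.prems(7) sep sep' by (metis insertE rtrancl.rtrancl_refl)
    qed
    then show ?thesis using sumV[OF y] less.prems(10)[of y] by simp
  qed
qed

section \<open>Combinatorial meaning of finite homology\<close>

lemma maximal_set_of_bounded_card:
  assumes "\<Phi> {}" and "\<And>S. \<Phi> S \<Longrightarrow> finite S \<and> card S \<le> (r::nat)"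
  obtains S where "\<Phi> S" "finite S" "\<And>x. x \<notin> S \<Longrightarrow> \<not> \<Phi> (insert x S)"
proof -
  obtain S where S: "\<Phi> S" "\<And>T. \<Phi> T \<Longrightarrow> card T \<le> card S"
    using ex_has_greatest_nat[of \<Phi> "{}" card "Suc r"] assms by (metis less_Suc_eq_le)
  have fin: "finite S" using S(1) assms(2) by blast
  then have "\<not> \<Phi> (insert x S)" if "x \<notin> S" for x
    using S(2)[of "insert x S"] that by auto
  then show ?thesis using that S(1) fin by blast
qed

lemma quiver_boundary_of: "quiver_boundary (frag_of a) = frag_of (snd a) - frag_of (fst a)"
  by (simp add: quiver_boundary_def)

lemma quiver_boundary_diff: "quiver_boundary (x - y) = quiver_boundary x - quiver_boundary y"
  by (simp add: quiver_boundary_def frag_extend_diff)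

lemma quiver_boundary_add: "quiver_boundary (x + y) = quiver_boundary x + quiver_boundary y"
  by (simp add: quiver_boundary_def frag_extend_add)

lemma quiver_boundary_hom:
  assumes "pair_wf_digraph Q"
  shows "quiver_boundary \<in> hom (free_Abelian_group (parcs Q)) (free_Abelian_group (pverts Q))"
proof -
  note ends = pair_wf_digraph.arc_fst_in_verts[OF assms] pair_wf_digraph.arc_snd_in_verts[OF assms]
  have "Poly_Mapping.keys (quiver_boundary x) \<subseteq> pverts Q"
    if "Poly_Mapping.keys x \<subseteq> parcs Q" for x
    using that
  proof (induction x rule: frag_induction)
    case zero
    then show ?case by (simp add: quiver_boundary_def)
  next
    case (one a)
    have "Poly_Mapping.keys (frag_of (snd a) - frag_of (fst a) :: _ \<Rightarrow>\<^sub>0 int) \<subseteq> {snd a, fst a}"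
      using keys_diff[of "frag_of (snd a)" "frag_of (fst a)"] by (auto simp: keys_frag_of)
    then show ?case
      using ends(1)[OF one] ends(2)[OF one] by (auto simp: quiver_boundary_of)
  next
    case (diff a b)
    then show ?case
      using keys_diff[of "quiver_boundary a" "quiver_boundary b"]
      by (auto simp: quiver_boundary_diff)
  qed
  then show ?thesis
    by (auto simp: hom_def quiver_boundary_add)
qed

lemma path_chain:
  assumes "(u, v) \<in> linked A"
  obtains z where "Poly_Mapping.keys z \<subseteq> A" "quiver_boundary z = frag_of v - frag_of u"
proof -
  have "\<exists>z. Poly_Mapping.keys z \<subseteq> A \<and> quiver_boundary z = frag_of v - frag_of u"
    using assms
  proof (induction rule: rtrancl_induct)
    case base
    show ?case by (rule exI[of _ 0]) (simp add: quiver_boundary_def)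
  next
    case (step y x)
    then obtain z where z: "Poly_Mapping.keys z \<subseteq> A" "quiver_boundary z = frag_of y - frag_of u"
      by blast
    from step.hyps(2) consider "(y, x) \<in> A" | "(x, y) \<in> A" by auto
    then show ?case
    proof cases
      case 1
      then show ?thesis
        using z keys_add[of z "frag_of (y, x)"]
        by (intro exI[of _ "z + frag_of (y, x)"])
          (auto simp: quiver_boundary_add quiver_boundary_of keys_frag_of)
    next
      case 2
      then show ?thesis
        using z keys_diff[of z "frag_of (x, y)"]
        by (intro exI[of _ "z - frag_of (x, y)"])
          (auto simp: quiver_boundary_diff quiver_boundary_of keys_frag_of)
    qed
  qed
  then show ?thesis using that by blast
qed

text \<open>
  Turns independence in the kernel subgroup, written multiplicatively, into independence of integral
  chains, whose coefficients can be compared arrow by arrow.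
\<close>
lemma int_independent_first_homology_iff:
  assumes wf: "pair_wf_digraph Q"
  shows "int_independent (first_homology Q) S \<longleftrightarrow>
    S \<subseteq> {z. Poly_Mapping.keys z \<subseteq> parcs Q \<and> quiver_boundary z = 0} \<and>
    (\<forall>T c. finite T \<longrightarrow> T \<subseteq> S \<longrightarrow> (\<Sum>z\<in>T. frag_cmul (c z) z) = 0 \<longrightarrow> (\<forall>z\<in>T. c z = 0))"
proof -
  let ?G = "free_Abelian_group (parcs Q)"
  let ?Z = "kernel ?G (free_Abelian_group (pverts Q)) quiver_boundary"
  note G = group_free_Abelian_group[of "parcs Q"]
  have bd: "group_hom ?G (free_Abelian_group (pverts Q)) quiver_boundary"
    using quiver_boundary_hom[OF wf] by (simp add: group_hom_def group_hom_axioms_def)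
  have carr: "carrier (first_homology Q) = ?Z"
    unfolding first_homology_def
    by (rule subgroup.carrier_subgroup_generated_subgroup[OF group_hom.subgroup_kernel[OF bd]])
  have Z: "?Z = {z. Poly_Mapping.keys z \<subseteq> parcs Q \<and> quiver_boundary z = 0}"
    by (auto simp: kernel_def)
  have H: "comm_group (first_homology Q)"
    unfolding first_homology_def
    by (rule group.abelian_subgroup_generated[OF G abelian_free_Abelian_group])
  note H_monoid = comm_group.axioms(1)[OF H] and H_group = comm_group.axioms(2)[OF H]
  have one: "\<one>\<^bsub>first_homology Q\<^esub> = 0"
    and mult: "x \<otimes>\<^bsub>first_homology Q\<^esub> y = x + y" for x y
    by (simp_all add: first_homology_def)
  have "finprod (first_homology Q) (\<lambda>x. x [^]\<^bsub>first_homology Q\<^esub> (c x :: int)) T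
      = (\<Sum>z\<in>T. frag_cmul (c z) z)" if "finite T" "T \<subseteq> ?Z" for T c
    using that
  proof (induction T rule: finite_induct)
    case empty
    then show ?case by (simp add: one comm_monoid.finprod_empty[OF H_monoid])
  next
    case (insert x F)
    have pow: "y [^]\<^bsub>first_homology Q\<^esub> (c y :: int) \<in> ?Z"
        "y [^]\<^bsub>first_homology Q\<^esub> (c y :: int) = frag_cmul (c y) y" if "y \<in> ?Z" for y
    proof -
      show "y [^]\<^bsub>first_homology Q\<^esub> (c y :: int) \<in> ?Z"
        using group.int_pow_closed[OF H_group, of y "c y"] that carr by simp
      show "y [^]\<^bsub>first_homology Q\<^esub> (c y :: int) = frag_cmul (c y) y"
        using group.int_pow_subgroup_generated[OF G, of y ?Z "c y"] that carr Z
        by (simp add: first_homology_def)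
    qed
    have "finprod (first_homology Q) (\<lambda>x. x [^]\<^bsub>first_homology Q\<^esub> (c x :: int)) (insert x F)
      = x [^]\<^bsub>first_homology Q\<^esub> (c x :: int) \<otimes>\<^bsub>first_homology Q\<^esub>
        finprod (first_homology Q) (\<lambda>x. x [^]\<^bsub>first_homology Q\<^esub> (c x :: int)) F"
      by (rule comm_monoid.finprod_insert[OF H_monoid]) (use insert pow(1) carr in auto)
    then show ?case
      using insert pow(2)[of x] by (simp add: mult)
  qed
  then show ?thesis
    unfolding int_independent_def carr Z one
    by (intro conj_cong refl all_cong1 imp_cong) auto
qed

text \<open>
  A maximal independent set \<open>S\<close> of cycles has finite total support.  If an arrow \<open>a\<close> outside this
  support were not a bridge, a path between its ends that avoids \<open>a\<close> would close it to a cycle with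
  coefficient \<open>1\<close> at \<open>a\<close>.  As the elements of \<open>S\<close> vanish at \<open>a\<close>, this cycle would extend \<open>S\<close>.
\<close>
lemma finite_nonbridges_of_finite_first_homology:
  assumes wf: "pair_wf_digraph Q" and "finite_rank (first_homology Q)"
  shows "finite {a \<in> parcs Q. (fst a, snd a) \<in> linked (parcs Q - {a})}"
proof -
  let ?ind = "int_independent (first_homology Q)"
  note iff = int_independent_first_homology_iff[OF wf]
  obtain r where r: "\<And>S. ?ind S \<Longrightarrow> finite S \<and> card S \<le> r"
    using assms(2) unfolding finite_rank_def by blast
  have "?ind {}" by (simp add: iff)
  then obtain S where S: "?ind S" "finite S" "\<And>z. z \<notin> S \<Longrightarrow> \<not> ?ind (insert z S)"
    using maximal_set_of_bounded_card[of ?ind r] r by blast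
  have "a \<in> (\<Union>z\<in>S. Poly_Mapping.keys z)"
    if a: "a \<in> parcs Q" "(fst a, snd a) \<in> linked (parcs Q - {a})" for a
  proof (rule ccontr)
    assume na: "a \<notin> (\<Union>z\<in>S. Poly_Mapping.keys z)"
    obtain p where p: "Poly_Mapping.keys p \<subseteq> parcs Q - {a}"
        "quiver_boundary p = frag_of (snd a) - frag_of (fst a)"
      using path_chain[OF a(2)] .
    define z where "z = frag_of a - p"
    have pa: "Poly_Mapping.lookup p a = 0" using p(1) by (auto simp: in_keys_iff)
    have za: "Poly_Mapping.lookup z a = 1" by (simp add: z_def lookup_minus pa)
    have Sa: "Poly_Mapping.lookup x a = 0" if "x \<in> S" for x
      using na that by (auto simp: in_keys_iff)
    have zS: "z \<notin> S" using za Sa by fastforce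
    have cyc: "Poly_Mapping.keys z \<subseteq> parcs Q \<and> quiver_boundary z = 0"
      using p a(1) keys_diff[of "frag_of a" p]
      by (auto simp: z_def quiver_boundary_diff quiver_boundary_of keys_frag_of)
    have "\<forall>x\<in>T. c x = 0"
      if T: "finite T" "T \<subseteq> insert z S" "(\<Sum>x\<in>T. frag_cmul (c x) x) = 0" for T c
    proof -
      have T': "T - {z} \<subseteq> S" "finite (T - {z})" using T by auto
      have cz: "c z = 0" if "z \<in> T"
      proof -
        have "0 = Poly_Mapping.lookup (\<Sum>x\<in>T. frag_cmul (c x) x) a" using T(3) by simp
        also have "\<dots> = (\<Sum>x\<in>T. c x * Poly_Mapping.lookup x a)" by (simp add: lookup_sum)
        also have "\<dots> = c z * Poly_Mapping.lookup z a +
            (\<Sum>x\<in>T - {z}. c x * Poly_Mapping.lookup x a)"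
          using that T(1) by (simp add: sum.remove)
        also have "(\<Sum>x\<in>T - {z}. c x * Poly_Mapping.lookup x a) = 0"
          using Sa T'(1) by (intro sum.neutral) auto
        finally show ?thesis using za by simp
      qed
      have "(\<Sum>x\<in>T - {z}. frag_cmul (c x) x) = (\<Sum>x\<in>T. frag_cmul (c x) x)"
        by (rule sum.mono_neutral_left) (use T(1) cz in auto)
      then have "(\<Sum>x\<in>T - {z}. frag_cmul (c x) x) = 0" using T(3) by simp
      then have "\<forall>x\<in>T - {z}. c x = 0"
        by (rule S(1)[unfolded iff, THEN conjunct2, rule_format, OF T'(2,1), THEN ballI])
      then show ?thesis using cz by blast
    qed
    then have "?ind (insert z S)" using cyc S(1) unfolding iff by auto
    then show False using S(3)[OF zS] by blast
  qed
  then have "{a \<in> parcs Q. (fst a, snd a) \<in> linked (parcs Q - {a})} \<subseteq> (\<Union>z\<in>S. Poly_Mapping.keys z)"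
    by blast
  then show ?thesis
    by (rule finite_subset) (use S(2) in simp)
qed

text \<open>
  The augmentation taken separately on each component.  It kills boundaries, so it detects
  independence in the zeroth homology.
\<close>
definition component_class :: "'a pair_pre_digraph \<Rightarrow> ('a \<Rightarrow>\<^sub>0 int) \<Rightarrow> ('a set \<Rightarrow>\<^sub>0 int)" where
  "component_class Q = frag_extend (\<lambda>v. frag_of (linked (parcs Q) `` {v}))"

lemma linked_class_eq_iff:
  "linked A `` {u} = linked A `` {v} \<longleftrightarrow> (u, v) \<in> linked A"
proof
  assume "linked A `` {u} = linked A `` {v}"
  then have "v \<in> linked A `` {u}" by simp
  then show "(u, v) \<in> linked A" by simp
next
  assume "(u, v) \<in> linked A"
  then show "linked A `` {u} = linked A `` {v}"
    using linked_sym[of u v A] by (auto intro: rtrancl_trans)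
qed

lemma component_class_boundary:
  assumes "Poly_Mapping.keys z \<subseteq> parcs Q"
  shows "component_class Q (quiver_boundary z) = 0"
  using assms
proof (induction z rule: frag_induction)
  case zero
  then show ?case by (simp add: component_class_def quiver_boundary_def)
next
  case (one a)
  then have "linked (parcs Q) `` {fst a} = linked (parcs Q) `` {snd a}"
    unfolding linked_class_eq_iff by (rule linked_arc)
  then show ?case by (simp add: component_class_def quiver_boundary_of frag_extend_diff)
next
  case (diff a b)
  then show ?case by (simp add: component_class_def quiver_boundary_diff frag_extend_diff)
qed

text \<open>
  A relation between the cosets of the vertices in \<open>U\<close> lifts to a chain that is a boundary.  The map
  \<open>component_class\<close> sends it to \<open>0\<close>, yet it sends the vertices in \<open>U\<close> to distinct basis elements.
  Hence all coefficients vanish.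
\<close>
lemma int_independent_zeroth_homology:
  assumes wf: "pair_wf_digraph Q" and U: "U \<subseteq> pverts Q"
    and sep: "\<And>u v. u \<in> U \<Longrightarrow> v \<in> U \<Longrightarrow> (u, v) \<in> linked (parcs Q) \<Longrightarrow> u = v"
  defines "h \<equiv> \<lambda>u. (quiver_boundary ` carrier (free_Abelian_group (parcs Q)))
      #>\<^bsub>free_Abelian_group (pverts Q)\<^esub> frag_of u"
  shows "inj_on h U" "int_independent (zeroth_homology Q) (h ` U)"
proof -
  let ?G = "free_Abelian_group (pverts Q)"
  let ?N = "quiver_boundary ` carrier (free_Abelian_group (parcs Q))"
  let ?K = "zeroth_homology Q"
  let ?\<pi> = "\<lambda>x. ?N #>\<^bsub>?G\<^esub> x"
  note G = group_free_Abelian_group[of "pverts Q"]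
  note G_comm = abelian_free_Abelian_group[of "pverts Q"]
  have bd: "group_hom (free_Abelian_group (parcs Q)) ?G quiver_boundary"
    using quiver_boundary_hom[OF wf] by (simp add: group_hom_def group_hom_axioms_def)
  have N: "subgroup ?N ?G" by (rule group_hom.img_is_subgroup[OF bd])
  have K: "?K = ?G Mod ?N" by (simp add: zeroth_homology_def)
  have K_comm: "comm_group ?K" unfolding K by (rule comm_group.abelian_FactGroup[OF G_comm N])
  note K_monoid = comm_group.axioms(1)[OF K_comm] and K_group = comm_group.axioms(2)[OF K_comm]
  have p: "group_hom ?G ?K ?\<pi>"
    using normal.r_coset_hom_Mod[OF comm_group.subgroup_imp_normal[OF G_comm N]] K_group
    by (simp add: group_hom_def group_hom_axioms_def K)
  have class_N: "component_class Q x = 0" if "x \<in> ?N" for x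
    using that by (auto simp: component_class_boundary)
  have carr: "frag_of u \<in> carrier ?G" if "u \<in> U" for u
    using that U by (auto simp: keys_frag_of)
  have hK: "h u \<in> carrier ?K" if "u \<in> U" for u
    using group_hom.hom_closed[OF p carr[OF that]] by (simp add: h_def)
  show inj: "inj_on h U"
  proof (rule inj_onI)
    fix u v assume uv: "u \<in> U" "v \<in> U" "h u = h v"
    have "frag_of u \<in> ?N #>\<^bsub>?G\<^esub> frag_of v"
      using group.rcos_self[OF G carr[OF uv(1)] N] uv(3) by (simp add: h_def)
    then obtain x where x: "x \<in> ?N" "frag_of u = x + frag_of v"
      by (auto simp: r_coset_def)
    then have "component_class Q (frag_of u) = component_class Q (frag_of v)"
      using class_N[OF x(1)] by (simp add: component_class_def frag_extend_add)
    then have "(u, v) \<in> linked (parcs Q)"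
      by (simp add: component_class_def frag_of_eq linked_class_eq_iff)
    then show "u = v" using sep uv by blast
  qed
  have comb: "(\<Sum>u\<in>W. frag_cmul (c (h u)) (frag_of u)) \<in> carrier ?G \<and>
      finprod ?K (\<lambda>X. X [^]\<^bsub>?K\<^esub> (c X :: int)) (h ` W)
      = ?\<pi> (\<Sum>u\<in>W. frag_cmul (c (h u)) (frag_of u))"
    if "finite W" "W \<subseteq> U" for W c
    using that
  proof (induction W rule: finite_induct)
    case empty
    then show ?case using group_hom.hom_one[OF p] by (simp add: comm_monoid.finprod_empty[OF K_monoid])
  next
    case (insert u W)
    let ?s = "\<Sum>u\<in>W. frag_cmul (c (h u)) (frag_of u)"
    have u: "u \<in> U" "W \<subseteq> U" and s: "?s \<in> carrier ?G" using insert by auto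
    have hu: "h u \<notin> h ` W" using inj insert(2) u by (auto dest: inj_onD)
    have pw: "h u [^]\<^bsub>?K\<^esub> (c (h u) :: int) = ?\<pi> (frag_cmul (c (h u)) (frag_of u))"
      using group_hom.hom_int_pow[OF p carr[OF u(1)], of "c (h u)"] carr[OF u(1)] by (simp add: h_def)
    have fc: "frag_cmul (c (h u)) (frag_of u) \<in> carrier ?G"
      using carr[OF u(1)] by auto
    have "finprod ?K (\<lambda>X. X [^]\<^bsub>?K\<^esub> (c X :: int)) (h ` insert u W)
        = h u [^]\<^bsub>?K\<^esub> (c (h u)) \<otimes>\<^bsub>?K\<^esub> finprod ?K (\<lambda>X. X [^]\<^bsub>?K\<^esub> (c X :: int)) (h ` W)"
      unfolding image_insert
      by (rule comm_monoid.finprod_insert[OF K_monoid])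
        (use insert(1) hu u hK in \<open>auto intro!: group.int_pow_closed[OF K_group]\<close>)
    also have "\<dots> = ?\<pi> (frag_cmul (c (h u)) (frag_of u)) \<otimes>\<^bsub>?K\<^esub> ?\<pi> ?s"
      using insert.IH[OF u(2)] pw by simp
    also have "\<dots> = ?\<pi> (frag_cmul (c (h u)) (frag_of u) + ?s)"
      using group_hom.hom_mult[OF p fc s] by simp
    finally show ?case
      using insert(1,2) monoid.m_closed[OF group.is_monoid[OF G] fc s] by simp
  qed
  show "int_independent ?K (h ` U)"
    unfolding int_independent_def
  proof (intro conjI allI impI)
    show "h ` U \<subseteq> carrier ?K" using hK by blast
    fix T and c :: "_ \<Rightarrow> int"
    assume T: "finite T" "T \<subseteq> h ` U"
      and zero: "finprod ?K (\<lambda>X. X [^]\<^bsub>?K\<^esub> c X) T = \<one>\<^bsub>?K\<^esub>"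
    obtain W where W: "W \<subseteq> U" "finite W" "T = h ` W"
      using T by (meson finite_subset_image)
    let ?s = "\<Sum>u\<in>W. frag_cmul (c (h u)) (frag_of u)"
    have "?\<pi> ?s = ?N" and s: "?s \<in> carrier ?G"
      using comb[OF W(2,1), of c] zero W(3) by (simp_all add: K FactGroup_def)
    then have "?s \<in> ?N" using group.coset_join1[OF G _ s N] by blast
    then have "0 = component_class Q ?s" using class_N by simp
    also have "\<dots> = (\<Sum>u\<in>W. frag_cmul (c (h u)) (frag_of (linked (parcs Q) `` {u})))"
      using W(2) by (simp add: component_class_def frag_extend_sum frag_extend_cmul)
    finally have 0: "(\<Sum>u\<in>W. frag_cmul (c (h u)) (frag_of (linked (parcs Q) `` {u}))) = 0" by simp
    have "c (h v) = 0" if v: "v \<in> W" for v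
    proof -
      have eq: "linked (parcs Q) `` {v} = linked (parcs Q) `` {u} \<longleftrightarrow> u = v" if "u \<in> W" for u
        unfolding linked_class_eq_iff using sep that v W(1) by blast
      have "0 = Poly_Mapping.lookup
          (\<Sum>u\<in>W. frag_cmul (c (h u)) (frag_of (linked (parcs Q) `` {u}))) (linked (parcs Q) `` {v})"
        using 0 by simp
      also have "\<dots> = (\<Sum>u\<in>W. if u = v then c (h u) else 0)"
        unfolding lookup_sum by (rule sum.cong) (simp_all add: eq)
      also have "\<dots> = c (h v)" using v W(2) by simp
      finally show ?thesis by simp
    qed
    then show "\<forall>X\<in>T. c X = 0" using W(3) by blast
  qed
qed

text \<open>
  A maximal set of pairwise unlinked vertices meets every component; its size is bounded by the rank.
\<close>
lemma finite_representatives_of_finite_zeroth_homology: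
  assumes wf: "pair_wf_digraph Q" and "finite_rank (zeroth_homology Q)"
  obtains R where "finite R" "R \<subseteq> pverts Q"
    "\<And>v. v \<in> pverts Q \<Longrightarrow> \<exists>r\<in>R. (r, v) \<in> linked (parcs Q)"
proof -
  define \<Phi> where "\<Phi> U \<longleftrightarrow> U \<subseteq> pverts Q \<and>
    (\<forall>u\<in>U. \<forall>v\<in>U. (u, v) \<in> linked (parcs Q) \<longrightarrow> u = v)" for U
  obtain r where r: "\<And>S. int_independent (zeroth_homology Q) S \<Longrightarrow> finite S \<and> card S \<le> r"
    using assms(2) unfolding finite_rank_def by blast
  have "finite U \<and> card U \<le> r" if "\<Phi> U" for U
  proof -
    have U: "U \<subseteq> pverts Q" "\<And>u v. u \<in> U \<Longrightarrow> v \<in> U \<Longrightarrow> (u, v) \<in> linked (parcs Q) \<Longrightarrow> u = v"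
      using that by (auto simp: \<Phi>_def)
    note ind = int_independent_zeroth_homology[OF wf U]
    show ?thesis
      using r[OF ind(2)] finite_imageD[OF _ ind(1)] card_image[OF ind(1)] by metis
  qed
  moreover have "\<Phi> {}" by (simp add: \<Phi>_def)
  ultimately obtain R where R: "\<Phi> R" "finite R" "\<And>x. x \<notin> R \<Longrightarrow> \<not> \<Phi> (insert x R)"
    using maximal_set_of_bounded_card[of \<Phi> r] by blast
  have "\<exists>r\<in>R. (r, v) \<in> linked (parcs Q)" if v: "v \<in> pverts Q" for v
  proof (rule ccontr)
    assume *: "\<not> ?thesis"
    then have "v \<notin> R" by blast
    moreover have "\<Phi> (insert v R)"
      using R(1) v * linked_sym[of v _ "parcs Q"] unfolding \<Phi>_def by auto
    ultimately show False using R(3) by blast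
  qed
  then show ?thesis using that R(1,2) by (simp add: \<Phi>_def)
qed

section \<open>Monotonicity and convergence\<close>

text \<open>
  A bounded increasing net of integers attains its maximum and is constant from there on.
\<close>
lemma increasing_int_net_converges:
  fixes f :: "'a pair_pre_digraph \<Rightarrow> int"
  assumes wf: "pair_wf_digraph Q" and P0: "P0 \<in> finite_ICs Q"
    and mono: "\<And>P P'. P \<in> finite_ICs Q \<Longrightarrow> P' \<in> finite_ICs Q \<Longrightarrow>
      subquiver P0 P \<Longrightarrow> subquiver P P' \<Longrightarrow> f P \<le> f P'"
  shows "\<exists>L\<in>extended_ints. ((\<lambda>P. ereal (of_int (f P))) \<longlongrightarrow> L) (finite_ICs_at_top Q)"
proof -
  note ev = eventually_finite_ICs_at_top[OF wf]
  have P00: "subquiver P0 P0"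
    using P0 by (simp add: finite_ICs_def IC_def subquiver_iff)
  have trans: "subquiver P0 P'" if "subquiver P0 P" "subquiver P P'" for P P' :: "'a pair_pre_digraph"
    using that by (auto simp: subquiver_iff)
  show ?thesis
  proof (cases "\<exists>M. \<forall>P\<in>finite_ICs Q. subquiver P0 P \<longrightarrow> f P \<le> M")
    case True
    then obtain M where M: "\<And>P. P \<in> finite_ICs Q \<Longrightarrow> subquiver P0 P \<Longrightarrow> f P \<le> M" by blast
    \<comment> \<open>The distance to an upper bound is a natural number, so it has a least value.\<close>
    obtain P1 where P1: "P1 \<in> finite_ICs Q" "subquiver P0 P1"
      "\<And>P. P \<in> finite_ICs Q \<Longrightarrow> subquiver P0 P \<Longrightarrow> nat (M - f P1) \<le> nat (M - f P)"
      using ex_has_least_nat[of "\<lambda>P. P \<in> finite_ICs Q \<and> subquiver P0 P" P0 "\<lambda>P. nat (M - f P)"]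
        P0 P00 by blast
    have "f P = f P1" if "P \<in> finite_ICs Q" "subquiver P1 P" for P
      using mono[OF P1(1) that(1) P1(2) that(2)] P1(3)[OF that(1)] trans[OF P1(2) that(2)]
        M[OF that(1)] by simp
    then have "\<forall>\<^sub>F P in finite_ICs_at_top Q. ereal (of_int (f P)) = ereal (of_int (f P1))"
      unfolding ev using P1(1) by (intro bexI[of _ P1]) auto
    then have "((\<lambda>P. ereal (of_int (f P))) \<longlongrightarrow> ereal (of_int (f P1))) (finite_ICs_at_top Q)"
      by (rule tendsto_eventually)
    then show ?thesis by (auto simp: extended_ints_def)
  next
    case False
    have "((\<lambda>P. ereal (of_int (f P))) \<longlongrightarrow> \<infinity>) (finite_ICs_at_top Q)"
      unfolding tendsto_PInfty
    proof
      fix r :: real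
      obtain P1 where P1: "P1 \<in> finite_ICs Q" "subquiver P0 P1" "f P1 > \<lceil>r\<rceil>"
        using False by (meson not_le)
      have "ereal r < ereal (of_int (f P))" if "P \<in> finite_ICs Q" "subquiver P1 P" for P
        using mono[OF P1(1) that(1) P1(2) that(2)] P1(3) by (simp add: ceiling_less_iff)
      then show "\<forall>\<^sub>F P in finite_ICs_at_top Q. ereal r < ereal (of_int (f P))"
        unfolding ev using P1(1) by blast
    qed
    then show ?thesis by (auto simp: extended_ints_def)
  qed
qed

lemma finite_form_diff:
  assumes "pair_fin_digraph P'" "subquiver P P'"
    and const: "\<And>a. a \<in> parcs P' - parcs P \<Longrightarrow> n (fst a) = n (snd a)"
  shows "finite_form P' n - finite_form P n =
    (\<Sum>v\<in>pverts P' - pverts P. (n v)\<^sup>2) - (\<Sum>a\<in>parcs P' - parcs P. (n (fst a))\<^sup>2)"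
proof -
  have fin: "finite (pverts P')" "finite (parcs P')"
    using assms(1) by (simp_all add: pair_fin_digraph.pair_finite_verts
        pair_fin_digraph.pair_finite_arcs)
  have sub: "pverts P \<subseteq> pverts P'" "parcs P \<subseteq> parcs P'"
    using assms(2) by (auto simp: subquiver_iff)
  have "(\<Sum>a\<in>parcs P' - parcs P. n (fst a) * n (snd a)) = (\<Sum>a\<in>parcs P' - parcs P. (n (fst a))\<^sup>2)"
    using const by (intro sum.cong) (auto simp: power2_eq_square)
  then show ?thesis
    unfolding finite_form_def sum.subset_diff[OF sub(1) fin(1)] sum.subset_diff[OF sub(2) fin(2)]
    by linarith
qed

theorem corollary7p2:
  fixes Q :: "'a pair_pre_digraph" and n :: "'a \<Rightarrow> int"
  assumes "pair_wf_digraph Q"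
    and "finite_rank (zeroth_homology Q) \<or> finite_rank (first_homology Q)"
    and "n \<in> root_space Q"
  shows "\<exists>L\<in>extended_ints. form_converges_to Q n L"
proof -
  note wf = assms(1)
  define B where "B = {a \<in> parcs Q. n (fst a) \<noteq> n (snd a)}"
  have B: "finite B" "B \<subseteq> parcs Q"
    using assms(3) by (auto simp: root_space_def B_def)
  have ICs: "pair_fin_digraph P" "finite (pverts P)" "finite (parcs P)" "pverts P \<subseteq> pverts Q"
    "parcs P \<subseteq> parcs Q" "\<And>a. a \<in> parcs P \<Longrightarrow> fst a \<in> pverts P \<and> snd a \<in> pverts P"
    "\<And>u v. u \<in> pverts P \<Longrightarrow> v \<in> pverts P \<Longrightarrow> (u, v) \<in> linked (parcs Q) \<Longrightarrow> (u, v) \<in> linked (parcs P)"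
    if "P \<in> finite_ICs Q" for P
    using that unfolding finite_ICs_def IC_iff subquiver_iff
    by (simp_all add: pair_fin_digraph.pair_finite_verts pair_fin_digraph.pair_finite_arcs
        pair_wf_digraph.arc_fst_in_verts pair_wf_digraph.arc_snd_in_verts)
  have "\<exists>L\<in>extended_ints.
      ((\<lambda>P. ereal (of_int (finite_form P n))) \<longlongrightarrow> L) (finite_ICs_at_top Q)"
    using assms(2)
  proof
    assume "finite_rank (zeroth_homology Q)"
    then obtain R where R: "finite R" "R \<subseteq> pverts Q"
      "\<And>v. v \<in> pverts Q \<Longrightarrow> \<exists>r\<in>R. (r, v) \<in> linked (parcs Q)"
      using finite_representatives_of_finite_zeroth_homology[OF wf] by blast
    obtain P0 where P0: "P0 \<in> finite_ICs Q" "R \<subseteq> pverts P0" "B \<subseteq> parcs P0"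
      using finite_subset_of_finite_IC[OF wf R(1,2) B] by blast
    have "- finite_form P n \<le> - finite_form P' n"
      if P: "P \<in> finite_ICs Q" "P' \<in> finite_ICs Q" "subquiver P0 P" "subquiver P P'" for P P'
    proof -
      have sub: "pverts P \<subseteq> pverts P'" "parcs P \<subseteq> parcs P'" "R \<subseteq> pverts P" "B \<subseteq> parcs P"
        using P(3,4) P0(2,3) by (auto simp: subquiver_iff)
      have const: "n (fst a) = n (snd a)" if "a \<in> parcs P' - parcs P" for a
        using that sub(4) ICs(5)[OF P(2)] by (auto simp: B_def)
      have reach: "\<exists>u\<in>pverts P. (u, v) \<in> linked (parcs P')" if v: "v \<in> pverts P'" for v
      proof -
        obtain r where "r \<in> R" "(r, v) \<in> linked (parcs Q)"
          using R(3) v ICs(4)[OF P(2)] by blast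
        then show ?thesis using ICs(7)[OF P(2) _ v] sub(1,3) by blast
      qed
      have "(\<Sum>v\<in>pverts P' - pverts P. (n v)\<^sup>2) \<le> (\<Sum>a\<in>parcs P' - parcs P. (n (fst a))\<^sup>2)"
        by (rule sum_new_verts_le_sum_new_arcs[OF ICs(2,3)[OF P(2)] sub(1,2) ICs(6)[OF P(2)]
              ICs(6)[OF P(1)] reach]) (simp_all add: const)
      then show ?thesis
        using finite_form_diff[OF ICs(1)[OF P(2)] P(4) const] by simp
    qed
    then obtain L where L: "L \<in> extended_ints"
      "((\<lambda>P. ereal (of_int (- finite_form P n))) \<longlongrightarrow> L) (finite_ICs_at_top Q)"
      using increasing_int_net_converges[OF wf P0(1), of "\<lambda>P. - finite_form P n"] by blast
    have "((\<lambda>P. ereal (of_int (finite_form P n))) \<longlongrightarrow> - L) (finite_ICs_at_top Q)"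
      using tendsto_uminus_ereal[OF L(2)] by simp
    moreover have "- L \<in> extended_ints"
      using L(1) by (auto simp: extended_ints_def image_iff intro: exI[of _ "- _"])
    ultimately show ?thesis by blast
  next
    assume H1: "finite_rank (first_homology Q)"
    define C where "C = {a \<in> parcs Q. (fst a, snd a) \<in> linked (parcs Q - {a})}"
    have BC: "finite (B \<union> C)" "B \<union> C \<subseteq> parcs Q"
      using B finite_nonbridges_of_finite_first_homology[OF wf H1] by (auto simp: C_def)
    obtain P0 where P0: "P0 \<in> finite_ICs Q" "B \<union> C \<subseteq> parcs P0"
      using finite_subset_of_finite_IC[OF wf _ _ BC, of "{}"] by auto
    have "finite_form P n \<le> finite_form P' n"
      if P: "P \<in> finite_ICs Q" "P' \<in> finite_ICs Q" "subquiver P0 P" "subquiver P P'" for P P'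
    proof -
      have sub: "pverts P \<subseteq> pverts P'" "parcs P \<subseteq> parcs P'" "B \<subseteq> parcs P" "C \<subseteq> parcs P"
        using P(3,4) P0(2) by (auto simp: subquiver_iff)
      have const: "n (fst a) = n (snd a)" if "a \<in> parcs P' - parcs P" for a
        using that sub(3) ICs(5)[OF P(2)] by (auto simp: B_def)
      \<comment> \<open>An arrow that is a bridge of \<open>Q\<close> is a bridge of every subquiver that contains it.\<close>
      have bridge: "(fst a, snd a) \<notin> linked (parcs P' - {a})" if "a \<in> parcs P' - parcs P" for a
      proof
        assume "(fst a, snd a) \<in> linked (parcs P' - {a})"
        then have "(fst a, snd a) \<in> linked (parcs Q - {a})"
          by (rule linked_mono[rotated]) (use ICs(5)[OF P(2)] in auto)
        then show False using that sub(4) ICs(5)[OF P(2)] by (auto simp: C_def)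
      qed
      have IC: "(u, v) \<in> linked (parcs P)"
        if "u \<in> pverts P" "v \<in> pverts P" "(u, v) \<in> linked (parcs P')" for u v
        using ICs(7)[OF P(1) that(1,2)] linked_mono[OF ICs(5)[OF P(2)] that(3)] by blast
      have "(\<Sum>a\<in>parcs P' - parcs P. (n (fst a))\<^sup>2) \<le> (\<Sum>v\<in>pverts P' - pverts P. (n v)\<^sup>2)"
        by (rule sum_new_arcs_le_sum_new_verts[OF ICs(2,3)[OF P(2)] sub(1,2) ICs(6)[OF P(2)]
              ICs(6)[OF P(1)] IC bridge]) (simp_all add: const)
      then show ?thesis
        using finite_form_diff[OF ICs(1)[OF P(2)] P(4) const] by simp
    qed
    then show ?thesis by (rule increasing_int_net_converges[OF wf P0(1)])
  qed
  then show ?thesis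
    by (auto simp: form_converges_to_def limitin_subtopology extended_ints_def)
qed

end
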